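(* Let $n,m,l$ be positive integers with $m,l\le n$, and let $A\in\mathbb{R}^{n\times n}$, $B\in\mathbb{R}^{n\times m}$, $C\in\mathbb{R}^{l\times n}$, with $B$ and $C^{\mathsf T}$ of full column rank. Put $G=BB^{\mathsf T}$, $H=C^{\mathsf T}C$. Let $\gamma>0$ be such that $A_\gamma:=A-\gamma I_n$ and $K_\gamma:=A_\gamma^{\mathsf T}+HA_\gamma^{-1}G$ are nonsingular. Set $$A_0=I_n+2\gamma K_\gamma^{-\mathsf T},\qquad G_0=2\gamma A_\gamma^{-1}GK_\gamma^{-1},\qquad H_0=2\gamma K_\gamma^{-1}HA_\gamma^{-1},$$ and, for $k\ge0$, let $A_{k+1},G_{k+1},H_{k+1}$ be defined by the structure-preserving doubling algorithm (SDA) $$A_{k+1}=A_k(I_n+G_kH_k)^{-1}A_k,$$ $$G_{k+1}=G_k+A_k(I_n+G_kH_k)^{-1}G_kA_k^{\mathsf T},$$ $$H_{k+1}=H_k+A_k^{\mathsf T}H_k(I_n+G_kH_k)^{-1}A_k,$$ where it is assumed that $I_n+G_kH_k$ is nonsingular for all $k\ge0$. Let $\widetilde A_\gamma:=I_n+2\gamma A_\gamma^{-1}$, $U_0:=A_\gamma^{-1}B$, $V_0:=A_\gamma^{-\mathsf T}C^{\mathsf T}$ and, for $j\ge1$, $U_j:=\widetilde A_\gamma U_{j-1}$, $V_j:=\widetilde A_\gamma^{\mathsf T}V_{j-1}$. For $k\ge0$ put $\widehat U_k:=[U_0,U_1,\ldots,U_{2^k-1}]$, $\widehat V_k:=[V_0,V_1,\ldots,V_{2^k-1}]$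 and $T_k:=\widehat U_k^{\mathsf T}\widehat V_k$ (so $T_0=U_0^{\mathsf T}V_0$). Let $$Y_0:=B^{\mathsf T}A_\gamma^{-\mathsf T}C^{\mathsf T},\qquad Y_k:=\begin{bmatrix} 0 & Y_{k-1} \\ Y_{k-1} & 2\gamma T_{k-1} \end{bmatrix}\in\mathbb{R}^{2^km\times2^kl}\quad(k\ge1).$$ Then for all $k\ge1$, $$A_k=\widetilde A_\gamma^{2^k}-2\gamma\,\widehat U_k\left(I_{2^km}+Y_kY_k^{\mathsf T}\right)^{-1}Y_k\widehat V_k^{\mathsf T},$$ $$G_k=2\gamma\,\widehat U_k\left(I_{2^km}+Y_kY_k^{\mathsf T}\right)^{-1}\widehat U_k^{\mathsf T},\qquad H_k=2\gamma\,\widehat V_k\left(I_{2^kl}+Y_k^{\mathsf T}Y_k\right)^{-1}\widehat V_k^{\mathsf T}.$$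
   Context: $I_p$ is the $p\times p$ identity matrix, $M^{\mathsf T}$ is the transpose of $M$, and $M^{-\mathsf T}=(M^{-1})^{\mathsf T}$. $[U_0,\ldots,U_q]$ denotes the block row matrix obtained by concatenating columns. The SDA with these starting values is the iteration used to solve the continuous-time algebraic Riccati equation $A^{\mathsf T}X+XA-XGX+H=0$. *)

theory Defs
  imports
    Complex_Main
    "Jordan_Normal_Form.Gauss_Jordan_Elimination"
    "Jordan_Normal_Form.DL_Rank"
begin

text \<open>The inverse of a nonsingular square matrix; unspecified on all other matrices.\<close>

definition mat_inv :: "'a :: field mat \<Rightarrow> 'a mat" where
  "mat_inv A = the (mat_inverse A)"

lemma mat_inv:
  fixes A :: "'a :: field mat"
  assumes A: "A \<in> carrier_mat n n" and inv: "invertible_mat A"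
  shows "mat_inv A \<in> carrier_mat n n" "A * mat_inv A = 1\<^sub>m n" "mat_inv A * A = 1\<^sub>m n"
proof -
  obtain B where AB: "A * B = 1\<^sub>m n" and BA: "B * A = 1\<^sub>m (dim_row B)"
    using inv A unfolding invertible_mat_def inverts_mat_def by auto
  have "dim_col B = n"
    using arg_cong[OF AB, of dim_col] by simp
  moreover have "dim_row B = n"
    using arg_cong[OF BA, of dim_col] A by simp
  ultimately have B: "B \<in> carrier_mat n n" by auto
  have "A \<in> Units (ring_mat TYPE('a) n ())"
    using A B AB BA unfolding Units_def ring_mat_def by auto
  then obtain D where D: "mat_inverse A = Some D"
    using mat_inverse(1)[OF A, where b = "()"] by (cases "mat_inverse A") blast+
  show "mat_inv A \<in> carrier_mat n n" "A * mat_inv A = 1\<^sub>m n" "mat_inv A * A = 1\<^sub>m n"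
    using mat_inverse(2)[OF A D] D unfolding mat_inv_def by auto
qed

text \<open>The block row matrix \<open>[U 0, \<dots>, U (q - 1)]\<close> of blocks with \<open>n\<close> rows each.\<close>

definition block_row :: "nat \<Rightarrow> (nat \<Rightarrow> 'a mat) \<Rightarrow> nat \<Rightarrow> 'a mat" where
  "block_row n U q = mat_of_cols n (concat (map (\<lambda>j. cols (U j)) [0..<q]))"

text \<open>Over the reals the matrices \<open>I + Y Y\<^sup>T\<close> are always nonsingular, so their
  inverses never take an unspecified value.\<close>

lemma invertible_one_plus_gram:
  fixes Y :: "real mat"
  assumes Y: "Y \<in> carrier_mat r c"
  shows "invertible_mat (1\<^sub>m r + Y * Y\<^sup>T)"
proof -
  let ?M = "1\<^sub>m r + Y * Y\<^sup>T"
  have M: "?M \<in> carrier_mat r r" using Y by auto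
  have "det ?M \<noteq> 0"
  proof
    assume "det ?M = 0"
    then obtain v where v: "v \<in> carrier_vec r" "v \<noteq> 0\<^sub>v r" "?M *\<^sub>v v = 0\<^sub>v r"
      using det_0_iff_vec_prod_zero_field[OF M] by auto
    let ?w = "Y\<^sup>T *\<^sub>v v"
    have w: "?w \<in> carrier_vec c" using Y v by auto
    have "?M *\<^sub>v v = v + Y *\<^sub>v ?w"
      using Y v by (simp add: add_mult_distrib_mat_vec[of _ r r] assoc_mult_mat_vec[of _ r c _ r])
    then have "v + Y *\<^sub>v ?w = 0\<^sub>v r" using v(3) by argo
    then have "0 = v \<bullet> (v + Y *\<^sub>v ?w)"
      using scalar_prod_right_zero[OF v(1)] by metis
    also have "\<dots> = v \<bullet> v + v \<bullet> (Y *\<^sub>v ?w)"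
      using Y v w by (intro scalar_prod_add_distrib[of _ r]) auto
    also have "v \<bullet> (Y *\<^sub>v ?w) = ?w \<bullet> ?w"
      using Y v w transpose_vec_mult_scalar[OF Y w v(1)] by simp
    finally have "v \<bullet> v + ?w \<bullet> ?w = 0" by simp
    moreover have "v \<bullet> v > 0" 
      using conjugate_square_greater_0_vec[OF v(1)] v(2) by simp
    moreover have "?w \<bullet> ?w \<ge> 0"
      using conjugate_square_ge_0_vec[of ?w] by simp
    ultimately show False by linarith
  qed
  then have "?M \<in> Units (ring_mat TYPE(real) r ())"
    using det_non_zero_imp_unit[OF M] by auto
  then obtain X where X: "X \<in> carrier_mat r r" "X * ?M = 1\<^sub>m r" "?M * X = 1\<^sub>m r"
    unfolding Units_def ring_mat_def by auto
  have "inverts_mat ?M X" "inverts_mat X ?M" "square_mat ?M"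
    unfolding inverts_mat_def using X M by auto
  then show ?thesis unfolding invertible_mat_def by blast
qed

end

theory Submission
  imports Defs
begin

text \<open>
  Read \<open>X1 + G Z1 = A X0\<close>, \<open>Z0 = H X0 + A\<^sup>T Z1\<close> as a relation between \<open>(X0, Z0)\<close> and \<open>(X1, Z1)\<close>.
  One SDA step is the composition of this relation with itself. If \<open>A\<close>, \<open>G\<close>, \<open>H\<close> are given by the
  claimed formulas, the relation amounts to the existence of inner variables \<open>W\<close>, \<open>S\<close> with
  \<open>W = U\<^sup>T Z1 + Y S\<close>, \<open>S + Y\<^sup>T W = V\<^sup>T X0\<close>, \<open>X1 + c U W = F X0\<close>, \<open>Z0 = F\<^sup>T Z1 + c V S\<close>, where
  \<open>F\<close> is the power of the matrix \<open>I + 2\<gamma> A\<^sub>\<gamma>\<^sup>-\<^sup>1\<close> and \<open>c = 2\<gamma>\<close>. Composing two copies of this system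
  gives one of the same shape, with \<open>F\<^sup>2\<close>, \<open>[U, F U]\<close>, \<open>[V, F\<^sup>T V]\<close>, inner variables \<open>(W2; W1)\<close>
  and \<open>(S1; S2)\<close>, and exactly the block recursion for \<open>Y\<close>.
\<close>

text \<open>The matrix laws with dimension equations in place of carrier premises, so that the
  simplifier can discharge the side conditions.\<close>

lemma mult_assoc_mat_dim:
  "dim_col A = dim_row B \<Longrightarrow> dim_col B = dim_row C \<Longrightarrow> A * B * C = A * (B * (C :: 'a :: semiring_0 mat))"
  by (rule assoc_mult_mat[of _ "dim_row A" "dim_row B" _ "dim_row C" _ "dim_col C"]) auto

lemma mult_add_mat_dim:
  "dim_col A = dim_row B \<Longrightarrow> dim_row B = dim_row C \<Longrightarrow> dim_col B = dim_col C
    \<Longrightarrow> A * (B + C) = A * B + A * (C :: 'a :: semiring_0 mat)"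
  by (rule mult_add_distrib_mat[of _ "dim_row A" "dim_row B" _ "dim_col B"]) auto

lemma add_mult_mat_dim:
  "dim_row A = dim_row B \<Longrightarrow> dim_col A = dim_col B \<Longrightarrow> dim_col B = dim_row C
    \<Longrightarrow> (A + B) * C = A * C + B * (C :: 'a :: semiring_0 mat)"
  by (rule add_mult_distrib_mat[of _ "dim_row A" "dim_col A" _ _ "dim_col C"]) auto

lemma smult_mult_mat_dim:
  "dim_col A = dim_row B \<Longrightarrow> (c \<cdot>\<^sub>m A) * B = c \<cdot>\<^sub>m (A * (B :: 'a :: comm_semiring_0 mat))"
  by (rule mult_smult_assoc_mat) auto

lemma mult_smult_mat_dim:
  "dim_col A = dim_row B \<Longrightarrow> A * (c \<cdot>\<^sub>m B) = c \<cdot>\<^sub>m (A * (B :: 'a :: comm_semiring_0 mat))"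
  by (rule mult_smult_distrib) auto

lemma smult_add_mat_dim:
  "dim_row A = dim_row B \<Longrightarrow> dim_col A = dim_col B
    \<Longrightarrow> c \<cdot>\<^sub>m (A + B) = c \<cdot>\<^sub>m A + c \<cdot>\<^sub>m (B :: 'a :: semiring_0 mat)"
  by (rule add_smult_distrib_left_mat) auto

lemma transpose_mult_dim:
  "dim_col A = dim_row B \<Longrightarrow> (A * B)\<^sup>T = B\<^sup>T * (A :: 'a :: comm_semiring_0 mat)\<^sup>T"
  by (rule transpose_mult) auto

lemma transpose_add_dim:
  "dim_row A = dim_row B \<Longrightarrow> dim_col A = dim_col B \<Longrightarrow> (A + B)\<^sup>T = A\<^sup>T + B\<^sup>T"
  by (rule transpose_add) auto

lemma transpose_smult_mat: "(c \<cdot>\<^sub>m A)\<^sup>T = c \<cdot>\<^sub>m A\<^sup>T"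
  by (rule eq_matI) auto

lemma add_assoc_mat_dim:
  "dim_row A = dim_row B \<Longrightarrow> dim_col A = dim_col B \<Longrightarrow> dim_row B = dim_row C \<Longrightarrow> dim_col B = dim_col C
    \<Longrightarrow> A + B + C = A + (B + (C :: 'a :: semigroup_add mat))"
  by (rule eq_matI) (auto simp: add.assoc)

lemma add_commute_mat_dim:
  "dim_row A = dim_row B \<Longrightarrow> dim_col A = dim_col B \<Longrightarrow> A + B = B + (A :: 'a :: ab_semigroup_add mat)"
  by (rule eq_matI) (auto simp: add.commute)

lemma add_left_commute_mat_dim:
  "dim_row A = dim_row B \<Longrightarrow> dim_col A = dim_col B \<Longrightarrow> dim_row B = dim_row C \<Longrightarrow> dim_col B = dim_col C
    \<Longrightarrow> A + (B + C) = B + (A + (C :: 'a :: ab_semigroup_add mat))"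
  by (rule eq_matI) (auto simp: add.left_commute)

text \<open>Subtraction is largely kept out of the proofs: an identity is shown after adding a
  common term to both sides, and that term is cancelled here entrywise.\<close>

lemma add_right_imp_eq_mat:
  assumes "A + C = B + (C :: 'a :: cancel_ab_semigroup_add mat)"
    and "A \<in> carrier_mat r s" "B \<in> carrier_mat r s" "C \<in> carrier_mat r s"
  shows "A = B"
proof (rule eq_matI)
  fix i j assume "i < dim_row B" "j < dim_col B"
  with assms(2-4) arg_cong[OF assms(1), of "\<lambda>M. M $$ (i, j)"] show "A $$ (i, j) = B $$ (i, j)"
    by auto
qed (use assms in auto)

lemma minus_add_cancel_mat_dim:
  "dim_row A = dim_row B \<Longrightarrow> dim_col A = dim_col B \<Longrightarrow> A - B + B = (A :: 'a :: group_add mat)"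
  by (rule eq_matI) auto

lemma minus_eq_iff_mat:
  assumes "X \<in> carrier_mat r s" "A \<in> carrier_mat r s" "B \<in> carrier_mat r s"
  shows "X = A - B \<longleftrightarrow> X + B = (A :: 'a :: ring mat)"
  using assms by (auto simp: mat_eq_iff algebra_simps)

lemmas mat_dim_simps = mult_assoc_mat_dim mult_add_mat_dim add_mult_mat_dim smult_mult_mat_dim
  mult_smult_mat_dim smult_add_mat_dim transpose_mult_dim transpose_add_dim transpose_smult_mat

lemmas add_mat_ac = add_assoc_mat_dim add_commute_mat_dim add_left_commute_mat_dim

section \<open>Stacked blocks and their products\<close>

text \<open>Both stackings are \<open>four_block_mat\<close> with empty blocks, so that the product
  law for 2 by 2 block matrices covers them too.\<close>

definition hstack :: "'a :: zero mat \<Rightarrow> 'a mat \<Rightarrow> 'a mat" where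
  "hstack A B = four_block_mat A B (0\<^sub>m 0 (dim_col A)) (0\<^sub>m 0 (dim_col B))"

definition vstack :: "'a :: zero mat \<Rightarrow> 'a mat \<Rightarrow> 'a mat" where
  "vstack A B = four_block_mat A (0\<^sub>m (dim_row A) 0) B (0\<^sub>m (dim_row B) 0)"

lemma dim_stack [simp]:
  "dim_row (hstack A B) = dim_row A" "dim_col (hstack A B) = dim_col A + dim_col B"
  "dim_row (vstack A B) = dim_row A + dim_row B" "dim_col (vstack A B) = dim_col A"
  by (simp_all add: hstack_def vstack_def)

lemma transpose_hstack:
  "dim_row A = dim_row B \<Longrightarrow> (hstack A B)\<^sup>T = vstack A\<^sup>T B\<^sup>T"
  by (rule eq_matI) (auto simp: hstack_def vstack_def)

lemma vstack_add:
  assumes "dim_row A = dim_row C" "dim_row B = dim_row D"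
    "dim_col A = dim_col C" "dim_col B = dim_col D" "dim_col A = dim_col B"
  shows "vstack A B + vstack C D = vstack (A + C) (B + (D :: 'a :: monoid_add mat))"
  by (rule eq_matI) (use assms in \<open>auto simp: vstack_def\<close>)

lemma four_block_mult_vstack:
  fixes A :: "'a :: semiring_0 mat"
  assumes "A \<in> carrier_mat r1 s1" "B \<in> carrier_mat r1 s2" "C \<in> carrier_mat r2 s1" "D \<in> carrier_mat r2 s2"
    and "X \<in> carrier_mat s1 t" "Z \<in> carrier_mat s2 t"
  shows "four_block_mat A B C D * vstack X Z = vstack (A * X + B * Z) (C * X + D * Z)"
  unfolding vstack_def using assms
  by (subst mult_four_block_mat[OF assms(1-5) _ assms(6), of _ 0])
     (auto intro!: cong_four_block_mat)

lemma hstack_mult_vstack: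
  fixes A :: "'a :: semiring_0 mat"
  assumes "A \<in> carrier_mat r s1" "B \<in> carrier_mat r s2" "X \<in> carrier_mat s1 t" "Z \<in> carrier_mat s2 t"
  shows "hstack A B * vstack X Z = A * X + B * Z"
proof -
  have "hstack A B * vstack X Z = vstack (A * X + B * Z) (0\<^sub>m 0 s1 * X + 0\<^sub>m 0 s2 * Z)"
    using assms by (simp add: hstack_def four_block_mult_vstack[of _ r s1 _ s2 _ 0])
  also have "\<dots> = A * X + B * Z"
    using assms by (intro eq_matI) (auto simp: vstack_def)
  finally show ?thesis .
qed

lemma vstack_mult:
  fixes A :: "'a :: semiring_0 mat"
  assumes "A \<in> carrier_mat r1 s" "B \<in> carrier_mat r2 s" "X \<in> carrier_mat s t"
  shows "vstack A B * X = vstack (A * X) (B * X)"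
proof (rule eq_matI)
  fix i j assume "i < dim_row (vstack (A * X) (B * X))" "j < dim_col (vstack (A * X) (B * X))"
  moreover from this have "row (vstack A B) i = (if i < r1 then row A i else row B (i - r1))"
    using assms by (intro eq_vecI) (auto simp: vstack_def)
  ultimately show "(vstack A B * X) $$ (i, j) = vstack (A * X) (B * X) $$ (i, j)"
    using assms by (auto simp: vstack_def)
qed (use assms in auto)

section \<open>Block rows and matrix powers\<close>

lemma block_row_carrier:
  assumes "\<And>j. U j \<in> carrier_mat n p"
  shows "block_row n U q \<in> carrier_mat n (q * p)"
proof -
  have "length (concat (map (\<lambda>j. cols (U j)) [0..<q])) = q * p"
    using assms by (induction q) (auto simp: carrier_matD(2)[OF assms])
  then show ?thesis by (simp add: block_row_def carrier_matI)
qed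

lemma block_row_add:
  assumes U: "\<And>j. U j \<in> carrier_mat n p"
  shows "block_row n U (q + r) = hstack (block_row n U q) (block_row n (\<lambda>j. U (j + q)) r)"
proof -
  have "map (\<lambda>j. cols (U j)) [q..<q + r] = map (\<lambda>j. cols (U (j + q))) [0..<r]"
    by (auto intro!: nth_equalityI simp: add.commute)
  then have "block_row n U (q + r) = mat_of_cols n (concat (map (\<lambda>j. cols (U j)) [0..<q])
      @ concat (map (\<lambda>j. cols (U (j + q))) [0..<r]))"
    by (simp add: block_row_def upt_add_eq_append[of 0 q r])
  then show ?thesis
    by (auto intro!: eq_matI simp: block_row_def hstack_def mat_of_cols_index nth_append)
qed

text \<open>Multiplication by \<open>F\<close> acts on each column separately, and a block row is
  determined by the list of all columns of its blocks.\<close>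

lemma block_row_mult:
  assumes F: "F \<in> carrier_mat n n" and U: "\<And>j. U j \<in> carrier_mat n p"
  shows "block_row n (\<lambda>j. F * U j) q = F * block_row n U q"
proof -
  have "cols (F * U j) = map (\<lambda>v. F *\<^sub>v v) (cols (U j))" for j
    using F U[of j] by (auto intro!: nth_equalityI)
  then have "concat (map (\<lambda>j. cols (F * U j)) [0..<q])
      = map (\<lambda>v. F *\<^sub>v v) (concat (map (\<lambda>j. cols (U j)) [0..<q]))"
    by (simp add: map_concat comp_def)
  moreover have "set (concat (map (\<lambda>j. cols (U j)) [0..<q])) \<subseteq> carrier_vec n"
    using U cols_dim[of "U _"] by (fastforce simp: carrier_matD(1)[OF U])
  moreover have "mat_of_cols n (map (\<lambda>v. F *\<^sub>v v) vs) = F * mat_of_cols n vs"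
    if "set vs \<subseteq> carrier_vec n" for vs
  proof (rule mat_col_eqI)
    fix i assume "i < dim_col (F * mat_of_cols n vs)"
    then show "col (mat_of_cols n (map (\<lambda>v. F *\<^sub>v v) vs)) i = col (F * mat_of_cols n vs) i"
      using F that nth_mem[of i vs] by (subst col_mult2[of _ n n _ "length vs"]) (auto simp: subset_iff)
  qed (use F in auto)
  ultimately show ?thesis
    by (simp add: block_row_def)
qed

lemma power_mat_add:
  fixes F :: "'a :: semiring_1 mat"
  assumes "F \<in> carrier_mat n n"
  shows "F ^\<^sub>m (i + j) = F ^\<^sub>m i * F ^\<^sub>m j"
  using assms by (induction j) (auto simp flip: mult_assoc_mat_dim)

lemma transpose_power_mat:
  fixes F :: "'a :: comm_semiring_1 mat"
  assumes F: "F \<in> carrier_mat n n"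
  shows "(F ^\<^sub>m k)\<^sup>T = F\<^sup>T ^\<^sub>m k"
proof (induction k)
  case (Suc k)
  \<comment> \<open>In \<open>F ^\<^sub>m Suc k\<close> the new factor stands on the right.
    Transposition reverses the order, so the factor is first moved to the left.\<close>
  have "(F ^\<^sub>m Suc k)\<^sup>T = (F ^\<^sub>m 1 * F ^\<^sub>m k)\<^sup>T"
    using power_mat_add[OF F, of 1 k] by simp
  then show ?case using F Suc by (simp add: transpose_mult_dim)
qed (use F in simp)

text \<open>The recursion gives \<open>U (j + q) = F ^\<^sub>m q * U j\<close>, so the second half
  of the block row is a power of \<open>F\<close> times the first half.\<close>

lemma block_row_doubling:
  assumes F: "F \<in> carrier_mat n n" and U: "\<And>j. U j \<in> carrier_mat n p"
    and rec: "\<And>j. U (Suc j) = F * (U j :: 'a :: semiring_1 mat)"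
  shows "block_row n U (2 ^ Suc k) = hstack (block_row n U (2 ^ k)) (F ^\<^sub>m (2 ^ k) * block_row n U (2 ^ k))"
proof -
  have "U (j + q) = F ^\<^sub>m q * U j" for j q
  proof (induction q)
    case (Suc q)
    have "F ^\<^sub>m Suc q = F * F ^\<^sub>m q"
      using power_mat_add[OF F, of 1 q] F by simp
    then show ?case using Suc F U[of j] by (simp add: rec mult_assoc_mat_dim)
  qed (use U F in \<open>simp add: left_mult_one_mat[OF U]\<close>)
  then show ?thesis
    using block_row_add[where U = U and p = p and q = "2 ^ k" and r = "2 ^ k"] block_row_mult[where F = "F ^\<^sub>m (2 ^ k)" and U = U and p = p] F U
    by (simp add: mult_2)
qed

section \<open>Inverses of Gram matrices\<close>

text \<open>The last identity is the Woodbury formula linking the two inverses. All identities are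
  stated as sums because \<open>mat_dim_simps\<close> has no rule for differences.\<close>

lemma mat_inv_gram:
  fixes Y :: "real mat"
  assumes Y: "Y \<in> carrier_mat p q"
  defines "P \<equiv> mat_inv (1\<^sub>m p + Y * Y\<^sup>T)" and "Q \<equiv> mat_inv (1\<^sub>m q + Y\<^sup>T * Y)"
  shows "P \<in> carrier_mat p p" "P + Y * Y\<^sup>T * P = 1\<^sub>m p" "P + P * Y * Y\<^sup>T = 1\<^sub>m p"
    "P\<^sup>T = P" "Q \<in> carrier_mat q q" "Q + Y\<^sup>T * P * Y = 1\<^sub>m q"
proof -
  define M where "M = 1\<^sub>m p + Y * Y\<^sup>T"
  define N where "N = 1\<^sub>m q + Y\<^sup>T * Y"
  have M: "M \<in> carrier_mat p p" and N: "N \<in> carrier_mat q q"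
    using Y by (auto simp: M_def N_def)
  note MP = mat_inv[OF M invertible_one_plus_gram[OF Y, folded M_def], folded P_def[folded M_def]]
  note NQ = mat_inv[OF N, folded Q_def[folded N_def]]
  have "invertible_mat N"
    using invertible_one_plus_gram[of "Y\<^sup>T" q p] Y by (simp add: N_def)
  note NQ = NQ[OF this]
  show P: "P \<in> carrier_mat p p" and Q: "Q \<in> carrier_mat q q"
    using MP NQ by auto
  show PM: "P + Y * Y\<^sup>T * P = 1\<^sub>m p"
    using MP(2) P Y by (simp add: M_def mat_dim_simps)
  show "P + P * Y * Y\<^sup>T = 1\<^sub>m p"
    using MP(3) P Y by (simp add: M_def mat_dim_simps)
  have MT: "M\<^sup>T = M"
    using Y by (simp add: M_def mat_dim_simps)
  have "P\<^sup>T = P\<^sup>T * (M * P)"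
    using MP by simp
  also have "\<dots> = (M * P)\<^sup>T * P"
    using MT P M by (simp add: mat_dim_simps)
  also have "\<dots> = P"
    using MP P by simp
  finally show "P\<^sup>T = P" .
  \<comment> \<open>Since \<open>Y * N = M * Y\<close> and \<open>P * M\<close> is the identity,
    inserting \<open>N * Q\<close> turns \<open>Y\<^sup>T * P * Y\<close> into
    \<open>Y\<^sup>T * Y * Q\<close>.\<close>
  have "Q + Y\<^sup>T * P * Y = Q + Y\<^sup>T * P * Y * (N * Q)"
    using NQ P Y by simp
  also have "\<dots> = Q + Y\<^sup>T * (P * M) * Y * Q"
    using P Q Y by (simp add: M_def N_def mat_dim_simps)
  also have "\<dots> = N * Q"
    using MP Q Y by (simp add: N_def mat_dim_simps)
  finally show "Q + Y\<^sup>T * P * Y = 1\<^sub>m q"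
    using NQ by simp
qed

section \<open>The relation with inner variables and its composition\<close>

text \<open>\<open>X0\<close> and \<open>Z1\<close> enter, \<open>X1\<close> and \<open>Z0\<close>
  leave. Keeping \<open>W\<close> and \<open>S\<close> existential allows composition without any
  inverse. The arguments may have several columns, so that whole matrices can serve as test
  inputs.\<close>

definition scatters ::
  "real \<Rightarrow> real mat \<Rightarrow> real mat \<Rightarrow> real mat \<Rightarrow> real mat \<Rightarrow> real mat \<Rightarrow> real mat \<Rightarrow> real mat \<Rightarrow> real mat \<Rightarrow> bool" where
  "scatters c F U V Y X0 Z0 X1 Z1 \<longleftrightarrow> (\<exists>W S.
     W \<in> carrier_mat (dim_col U) (dim_col X0) \<and> S \<in> carrier_mat (dim_col V) (dim_col X0)
     \<and> W = U\<^sup>T * Z1 + Y * S \<and> S + Y\<^sup>T * W = V\<^sup>T * X0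
     \<and> X1 + c \<cdot>\<^sub>m (U * W) = F * X0 \<and> Z0 = F\<^sup>T * Z1 + c \<cdot>\<^sub>m (V * S))"

text \<open>Only \<open>X1\<close> and \<open>Z1\<close> are eliminated; the inner variables of both
  copies survive. Stacking \<open>(W2; W1)\<close> and \<open>(S1; S2)\<close> matches
  \<open>U * W2 + F * U * W1\<close> and \<open>V * S1 + F\<^sup>T * V * S2\<close>, and it puts the
  two copies of \<open>Y\<close> off the diagonal.\<close>

lemma scatters_comp:
  assumes F: "F \<in> carrier_mat n n" and U: "U \<in> carrier_mat n p" and V: "V \<in> carrier_mat n q"
    and Y: "Y \<in> carrier_mat p q"
    and X: "X0 \<in> carrier_mat n r" "X1 \<in> carrier_mat n r" "X2 \<in> carrier_mat n r"
    and Z: "Z0 \<in> carrier_mat n r" "Z1 \<in> carrier_mat n r" "Z2 \<in> carrier_mat n r"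
    and 1: "scatters c F U V Y X0 Z0 X1 Z1" and 2: "scatters c F U V Y X1 Z1 X2 Z2"
  shows "scatters c (F * F) (hstack U (F * U)) (hstack V (F\<^sup>T * V))
    (four_block_mat (0\<^sub>m p q) Y Y (c \<cdot>\<^sub>m (U\<^sup>T * V))) X0 Z0 X2 Z2"
proof -
  obtain W1 S1 where c1: "W1 \<in> carrier_mat p r" "S1 \<in> carrier_mat q r"
    and w1: "W1 = U\<^sup>T * Z1 + Y * S1" and s1: "S1 + Y\<^sup>T * W1 = V\<^sup>T * X0"
    and x1: "X1 + c \<cdot>\<^sub>m (U * W1) = F * X0" and z0: "Z0 = F\<^sup>T * Z1 + c \<cdot>\<^sub>m (V * S1)"
    using 1 U V X unfolding scatters_def by auto
  obtain W2 S2 where c2: "W2 \<in> carrier_mat p r" "S2 \<in> carrier_mat q r"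
    and w2: "W2 = U\<^sup>T * Z2 + Y * S2" and s2: "S2 + Y\<^sup>T * W2 = V\<^sup>T * X1"
    and x2: "X2 + c \<cdot>\<^sub>m (U * W2) = F * X1" and z1: "Z1 = F\<^sup>T * Z2 + c \<cdot>\<^sub>m (V * S2)"
    using 2 U V X unfolding scatters_def by auto
  let ?T = "c \<cdot>\<^sub>m (U\<^sup>T * V)"
  note dims = carrier_matD[OF F] carrier_matD[OF U] carrier_matD[OF V] carrier_matD[OF Y]
    carrier_matD[OF X(1)] carrier_matD[OF X(2)] carrier_matD[OF X(3)]
    carrier_matD[OF Z(1)] carrier_matD[OF Z(2)] carrier_matD[OF Z(3)]
    carrier_matD[OF c1(1)] carrier_matD[OF c1(2)] carrier_matD[OF c2(1)] carrier_matD[OF c2(2)]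
  note simps = dims mat_dim_simps add_mat_ac
  \<comment> \<open>Substituting \<open>Z1\<close> makes \<open>W1\<close> depend on
    \<open>S2\<close> through \<open>U\<^sup>T * V\<close>: this is the lower right block of the new
    \<open>Y\<close>.\<close>
  have w: "W1 = (F * U)\<^sup>T * Z2 + (Y * S1 + ?T * S2)"
  proof -
    have "W1 = U\<^sup>T * (F\<^sup>T * Z2 + c \<cdot>\<^sub>m (V * S2)) + Y * S1"
      using w1 z1 by simp
    then show ?thesis by (simp add: simps)
  qed
  \<comment> \<open>Dually, eliminating \<open>X1\<close> from the equation for \<open>S2\<close>
    produces the transpose of that block.\<close>
  have s: "S2 + (Y\<^sup>T * W2 + ?T\<^sup>T * W1) = (F\<^sup>T * V)\<^sup>T * X0"
  proof -
    have "(F\<^sup>T * V)\<^sup>T * X0 = V\<^sup>T * (X1 + c \<cdot>\<^sub>m (U * W1))"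
      by (simp add: x1 simps)
    also have "\<dots> = S2 + Y\<^sup>T * W2 + c \<cdot>\<^sub>m (V\<^sup>T * (U * W1))"
      by (simp add: s2 simps)
    finally show ?thesis by (simp add: simps)
  qed
  have x: "X2 + c \<cdot>\<^sub>m (U * W2 + F * U * W1) = F * F * X0"
  proof -
    have "F * F * X0 = F * (X1 + c \<cdot>\<^sub>m (U * W1))"
      by (simp add: x1 simps)
    also have "\<dots> = X2 + c \<cdot>\<^sub>m (U * W2) + c \<cdot>\<^sub>m (F * (U * W1))"
      by (simp add: x2 simps)
    finally show ?thesis by (simp add: simps)
  qed
  have z: "Z0 = (F * F)\<^sup>T * Z2 + c \<cdot>\<^sub>m (V * S1 + F\<^sup>T * V * S2)"
    unfolding z0 z1 by (simp add: simps)
  have FU: "F * U \<in> carrier_mat n p" and FV: "F\<^sup>T * V \<in> carrier_mat n q" and T: "?T \<in> carrier_mat p q"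
    using F U V by auto
  have "hstack U (F * U) * vstack W2 W1 = U * W2 + F * U * W1"
    "hstack V (F\<^sup>T * V) * vstack S1 S2 = V * S1 + F\<^sup>T * V * S2"
    by (rule hstack_mult_vstack[OF U FU c2(1) c1(1)], rule hstack_mult_vstack[OF V FV c1(2) c2(2)])
  moreover have "(hstack U (F * U))\<^sup>T * Z2 = vstack (U\<^sup>T * Z2) ((F * U)\<^sup>T * Z2)"
    using U FU by (simp add: transpose_hstack dims(1) vstack_mult[OF _ _ Z(3)])
  moreover have "(hstack V (F\<^sup>T * V))\<^sup>T * X0 = vstack (V\<^sup>T * X0) ((F\<^sup>T * V)\<^sup>T * X0)"
    using V FV by (simp add: transpose_hstack dims(1,2) vstack_mult[OF _ _ X(1)])
  moreover have "four_block_mat (0\<^sub>m p q) Y Y ?T * vstack S1 S2 = vstack (Y * S2) (Y * S1 + ?T * S2)"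
    using mult_carrier_mat[OF Y c2(2)]
    by (simp add: four_block_mult_vstack[OF zero_carrier_mat Y Y T c1(2) c2(2)] dims)
  moreover have "(four_block_mat (0\<^sub>m p q) Y Y ?T)\<^sup>T * vstack W2 W1
      = vstack (Y\<^sup>T * W1) (Y\<^sup>T * W2 + ?T\<^sup>T * W1)"
    using Y T mult_carrier_mat[OF _ c1(1), of "Y\<^sup>T"] by (simp add: transpose_four_block_mat[OF zero_carrier_mat Y Y T] dims
        four_block_mult_vstack[OF _ _ _ _ c2(1) c1(1), where ?r1.0 = q and ?r2.0 = q])
  \<comment> \<open>The first block rows are the untouched \<open>w2\<close> and \<open>s1\<close>,
    the second ones are \<open>w\<close> and \<open>s\<close>.\<close>
  ultimately have
    "vstack W2 W1 = (hstack U (F * U))\<^sup>T * Z2 + four_block_mat (0\<^sub>m p q) Y Y ?T * vstack S1 S2"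
    "vstack S1 S2 + (four_block_mat (0\<^sub>m p q) Y Y ?T)\<^sup>T * vstack W2 W1 = (hstack V (F\<^sup>T * V))\<^sup>T * X0"
    "X2 + c \<cdot>\<^sub>m (hstack U (F * U) * vstack W2 W1) = F * F * X0"
    "Z0 = (F * F)\<^sup>T * Z2 + c \<cdot>\<^sub>m (hstack V (F\<^sup>T * V) * vstack S1 S2)"
    using w[symmetric] w2[symmetric] s s1 x z by (simp_all add: vstack_add dims)
  moreover have "vstack W2 W1 \<in> carrier_mat (dim_col (hstack U (F * U))) (dim_col X0)"
    "vstack S1 S2 \<in> carrier_mat (dim_col (hstack V (F\<^sup>T * V))) (dim_col X0)"
    by (auto simp: dims)
  ultimately show ?thesis
    unfolding scatters_def by blast
qed

section \<open>Triples in the claimed closed form\<close>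

text \<open>The induction invariant, with general sizes and a general \<open>F\<close>. As a locale
  it can be interpreted for the old and the new triple side by side.\<close>

locale gram_form =
  fixes n p q :: nat and c :: real and F U V Y P Q A G H :: "real mat"
  assumes F: "F \<in> carrier_mat n n" and U: "U \<in> carrier_mat n p" and V: "V \<in> carrier_mat n q"
    and Y: "Y \<in> carrier_mat p q"
    and P_def: "P = mat_inv (1\<^sub>m p + Y * Y\<^sup>T)" and Q_def: "Q = mat_inv (1\<^sub>m q + Y\<^sup>T * Y)"
    and A_def: "A = F - c \<cdot>\<^sub>m (U * P * Y * V\<^sup>T)"
    and G_def: "G = c \<cdot>\<^sub>m (U * P * U\<^sup>T)"
    and H_def: "H = c \<cdot>\<^sub>m (V * Q * V\<^sup>T)"
begin

lemmas gram = mat_inv_gram[OF Y, folded P_def Q_def]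

lemma carriers: "A \<in> carrier_mat n n" "G \<in> carrier_mat n n" "H \<in> carrier_mat n n"
  using F U V Y gram by (auto simp: A_def G_def H_def)

text \<open>Eliminating \<open>S\<close> leaves \<open>(1 + Y * Y\<^sup>T) * W = U\<^sup>T * Z1 + Y
  * (V\<^sup>T * X0)\<close>, which \<open>P\<close> solves uniquely. Inserting the solution yields
  the coefficients \<open>A\<close>, \<open>G\<close>, \<open>H\<close>.\<close>

lemma scatters_iff:
  assumes X: "X0 \<in> carrier_mat n r" "X1 \<in> carrier_mat n r"
    and Z: "Z0 \<in> carrier_mat n r" "Z1 \<in> carrier_mat n r"
  shows "scatters c F U V Y X0 Z0 X1 Z1 \<longleftrightarrow> X1 + G * Z1 = A * X0 \<and> Z0 = H * X0 + A\<^sup>T * Z1"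
proof -
  define W where "W = P * (U\<^sup>T * Z1 + Y * (V\<^sup>T * X0))"
  define S where "S = V\<^sup>T * X0 - Y\<^sup>T * W"
  note dims = carrier_matD[OF F] carrier_matD[OF U] carrier_matD[OF V] carrier_matD[OF Y]
    carrier_matD[OF gram(1)] carrier_matD[OF gram(5)]
    carrier_matD[OF X(1)] carrier_matD[OF X(2)] carrier_matD[OF Z(1)] carrier_matD[OF Z(2)]
  note simps = dims mat_dim_simps add_mat_ac
  have W: "W \<in> carrier_mat p r" and S: "S \<in> carrier_mat q r"
    using dims by (auto simp: W_def S_def)
  have S_eq: "S + Y\<^sup>T * W = V\<^sup>T * X0"
    unfolding S_def by (rule minus_add_cancel_mat_dim) (use W in \<open>simp_all add: dims\<close>)
  have W_eq: "W = U\<^sup>T * Z1 + Y * S"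
  proof (rule add_right_imp_eq_mat[of _ "Y * (Y\<^sup>T * W)" _ p r])
    have "W + Y * (Y\<^sup>T * W) = (P + Y * Y\<^sup>T * P) * (U\<^sup>T * Z1 + Y * (V\<^sup>T * X0))"
      by (simp add: W_def simps)
    also have "\<dots> = U\<^sup>T * Z1 + Y * (S + Y\<^sup>T * W)"
      using gram by (simp add: dims S_eq)
    finally show "W + Y * (Y\<^sup>T * W) = U\<^sup>T * Z1 + Y * S + Y * (Y\<^sup>T * W)"
      using W S by (simp add: simps)
  qed (use W S dims in auto)
  \<comment> \<open>Multiplying by \<open>P\<close> from the left and using
    \<open>P + P * Y * Y\<^sup>T = 1\<close> recovers \<open>W'\<close> from the data, so the
    quantifier can be replaced by the fixed \<open>W\<close> and \<open>S\<close>.\<close>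
  have uniq: "W' = W \<and> S' = S"
    if c': "W' \<in> carrier_mat p r" "S' \<in> carrier_mat q r"
      and w: "W' = U\<^sup>T * Z1 + Y * S'" and s: "S' + Y\<^sup>T * W' = V\<^sup>T * X0" for W' S'
  proof
    have "W' = (P + P * Y * Y\<^sup>T) * W'"
      using gram c' by simp
    also have "\<dots> = P * (W' + Y * (Y\<^sup>T * W'))"
      using c' by (simp add: simps)
    also have "W' + Y * (Y\<^sup>T * W') = U\<^sup>T * Z1 + Y * (S' + Y\<^sup>T * W')"
    proof -
      have "W' + Y * (Y\<^sup>T * W') = (U\<^sup>T * Z1 + Y * S') + Y * (Y\<^sup>T * W')"
        using w by simp
      then show ?thesis using c' by (simp add: simps)
    qed
    finally show "W' = W"
      by (simp add: s W_def)
    then show "S' = S"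
      using s c' W dims unfolding S_def by (subst minus_eq_iff_mat[of _ q r]) auto
  qed
  have "scatters c F U V Y X0 Z0 X1 Z1
      \<longleftrightarrow> X1 + c \<cdot>\<^sub>m (U * W) = F * X0 \<and> Z0 = F\<^sup>T * Z1 + c \<cdot>\<^sub>m (V * S)" (is "?L = ?R")
  proof
    assume ?L
    then show ?R unfolding scatters_def dims using uniq by blast
  next
    assume ?R
    then show ?L unfolding scatters_def dims using W S W_eq S_eq by blast
  qed
  \<comment> \<open>The two equations differ by the same term \<open>?R\<close> on both sides, the
    part of \<open>c \<cdot>\<^sub>m (U * W)\<close> that comes from \<open>X0\<close>.\<close>
  also have "X1 + c \<cdot>\<^sub>m (U * W) = F * X0 \<longleftrightarrow> X1 + G * Z1 = A * X0"
  proof -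
    let ?R = "c \<cdot>\<^sub>m (U * (P * (Y * (V\<^sup>T * X0))))"
    have "A + c \<cdot>\<^sub>m (U * P * Y * V\<^sup>T) = F"
      unfolding A_def by (rule minus_add_cancel_mat_dim) (simp_all add: dims)
    from arg_cong[OF this, of "\<lambda>M. M * X0"] have *: "F * X0 = A * X0 + ?R"
      using carriers by (simp add: simps)
    have **: "X1 + c \<cdot>\<^sub>m (U * W) = X1 + G * Z1 + ?R"
      by (simp add: W_def G_def simps)
    have cs: "X1 + G * Z1 \<in> carrier_mat n r" "A * X0 \<in> carrier_mat n r" "?R \<in> carrier_mat n r"
      using carriers by (auto simp: dims)
    show ?thesis unfolding * ** using add_right_imp_eq_mat[OF _ cs] by auto
  qed
  \<comment> \<open>\<open>?R\<close> and \<open>?R'\<close> are the parts of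
    \<open>c \<cdot>\<^sub>m (V * (Y\<^sup>T * W))\<close> that come from \<open>Z1\<close> and
    \<open>X0\<close>. The first links \<open>F\<^sup>T\<close> to \<open>A\<^sup>T\<close>, by
    symmetry of \<open>P\<close>; the second cancels against the Woodbury identity and leaves
    \<open>H\<close>.\<close>
  also have "F\<^sup>T * Z1 + c \<cdot>\<^sub>m (V * S) = H * X0 + A\<^sup>T * Z1"
  proof -
    let ?R = "c \<cdot>\<^sub>m (V * (Y\<^sup>T * (P * (U\<^sup>T * Z1))))"
    let ?R' = "c \<cdot>\<^sub>m (V * (Y\<^sup>T * (P * (Y * (V\<^sup>T * X0)))))"
    have "A + c \<cdot>\<^sub>m (U * P * Y * V\<^sup>T) = F"
      unfolding A_def by (rule minus_add_cancel_mat_dim) (simp_all add: dims)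
    from arg_cong[OF this, of "\<lambda>M. M\<^sup>T * Z1"] have *: "F\<^sup>T * Z1 = A\<^sup>T * Z1 + ?R"
      using carriers by (simp add: simps gram(4))
    have "c \<cdot>\<^sub>m (V * S) + (?R + ?R') = c \<cdot>\<^sub>m (V * (S + Y\<^sup>T * W))"
      using S by (simp add: W_def simps)
    also have "\<dots> = c \<cdot>\<^sub>m (V * ((Q + Y\<^sup>T * P * Y) * (V\<^sup>T * X0)))"
      using gram by (simp add: S_eq dims)
    also have "\<dots> = H * X0 + ?R'"
      by (simp add: H_def simps)
    finally have **: "c \<cdot>\<^sub>m (V * S) + (?R + ?R') = H * X0 + ?R'" .
    have "c \<cdot>\<^sub>m (V * S) + ?R = H * X0"
      by (rule add_right_imp_eq_mat[of _ ?R' _ n r])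
         (use S carriers ** dims in \<open>auto simp: add_assoc_mat_dim\<close>)
    moreover have "F\<^sup>T * Z1 + c \<cdot>\<^sub>m (V * S) = c \<cdot>\<^sub>m (V * S) + ?R + A\<^sup>T * Z1"
      unfolding * using S carriers by (simp add: simps)
    ultimately show ?thesis by simp
  qed
  finally show ?thesis .
qed

end

section \<open>One doubling step\<close>

text \<open>The new triple is read off from the composed relation by test inputs. Eliminating
  \<open>Z1\<close> gives \<open>(1 + G * H) * X1 = A * X0 - G * A\<^sup>T * Z2\<close>, so
  \<open>N\<close> supplies the middle state for every \<open>X0\<close> and
  \<open>Z2\<close>.\<close>

lemma sda_step:
  assumes old: "gram_form n p q c F U V Y P Q A G H"
    and new: "gram_form n (p + p) (q + q) c (F * F) (hstack U (F * U)) (hstack V (F\<^sup>T * V))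
      (four_block_mat (0\<^sub>m p q) Y Y (c \<cdot>\<^sub>m (U\<^sup>T * V))) P' Q' A' G' H'"
    and inv: "invertible_mat (1\<^sub>m n + G * H)"
  defines "N \<equiv> mat_inv (1\<^sub>m n + G * H)"
  shows "A * N * A = A'" "G + A * N * G * A\<^sup>T = G'" "H + A\<^sup>T * H * N * A = H'"
proof -
  interpret old: gram_form n p q c F U V Y P Q A G H by (rule old)
  interpret new: gram_form n "p + p" "q + q" c "F * F" "hstack U (F * U)" "hstack V (F\<^sup>T * V)"
    "four_block_mat (0\<^sub>m p q) Y Y (c \<cdot>\<^sub>m (U\<^sup>T * V))" P' Q' A' G' H' by (rule new)
  note c = old.carriers and c' = new.carriers
  have N: "N \<in> carrier_mat n n" and N_eq: "N + G * H * N = 1\<^sub>m n"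
  proof -
    have M: "1\<^sub>m n + G * H \<in> carrier_mat n n" using c by auto
    note N = mat_inv[OF M inv, folded N_def]
    show "N \<in> carrier_mat n n" by (rule N)
    then show "N + G * H * N = 1\<^sub>m n" using N(2) c by (simp add: add_mult_mat_dim)
  qed
  note simps = carrier_matD[OF c(1)] carrier_matD[OF c(2)] carrier_matD[OF c(3)] carrier_matD[OF N]
    mat_dim_simps add_mat_ac
  have comp: "X2 + G' * Z2 = A' * X0 \<and> Z0 = H' * X0 + A'\<^sup>T * Z2"
    if "X1 + G * Z1 = A * X0" "Z0 = H * X0 + A\<^sup>T * Z1" "X2 + G * Z2 = A * X1" "Z1 = H * X1 + A\<^sup>T * Z2"
      and "X0 \<in> carrier_mat n n" "X1 \<in> carrier_mat n n" "X2 \<in> carrier_mat n n"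
      "Z0 \<in> carrier_mat n n" "Z1 \<in> carrier_mat n n" "Z2 \<in> carrier_mat n n"
    for X0 X1 X2 Z0 Z1 Z2
    using scatters_comp[OF old.F old.U old.V old.Y that(5-10), of c] that(1-4)
    unfolding old.scatters_iff[OF that(5,6,8,9)] old.scatters_iff[OF that(6,7,9,10)]
      new.scatters_iff[OF that(5,7,8,10)] by blast
  have N1: "N * X + G * (H * (N * X)) = X" if "X \<in> carrier_mat n n" for X
    using arg_cong[OF N_eq, of "\<lambda>M. M * X"] that by (simp add: simps)
  \<comment> \<open>Test input \<open>X0 = 1\<close>, \<open>Z2 = 0\<close>: the middle state is
    \<open>N * A\<close>, and the outputs are \<open>A'\<close> and \<open>H'\<close>.\<close>
  have "A * (N * A) + G' * 0\<^sub>m n n = A' * 1\<^sub>m n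
      \<and> H + A\<^sup>T * (H * (N * A)) = H' * 1\<^sub>m n + A'\<^sup>T * 0\<^sub>m n n"
    by (rule comp[of "N * A" "H * (N * A)"]) (use c N N1[OF c(1)] in \<open>auto simp: simps\<close>)
  then show "A * N * A = A'" "H + A\<^sup>T * H * N * A = H'"
    using c c' N by (auto simp: simps)
  \<comment> \<open>Test input \<open>X0 = 0\<close>, \<open>Z2 = -1\<close>: the middle state is
    \<open>X\<close>, and the sign makes the output \<open>X2\<close> equal to
    \<open>G'\<close>.\<close>
  define X where "X = N * (G * A\<^sup>T)"
  have X: "X \<in> carrier_mat n n" using c N by (auto simp: X_def)
  have neg: "M * - (1\<^sub>m n) = - M" "M + - M = 0\<^sub>m n n" if "M \<in> carrier_mat n n" for M :: "real mat"
    using that by (auto simp: uminus_mult_right_mat[symmetric] intro!: eq_matI)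
  have "X + G * (H * X) = G * A\<^sup>T"
    using N1[of "G * A\<^sup>T"] c by (simp add: X_def)
  moreover have "G * (H * X + A\<^sup>T * - (1\<^sub>m n)) = G * (H * X) + - (G * A\<^sup>T)"
    using c X neg by (subst mult_add_mat_dim) auto
  ultimately have "X + G * (H * X + A\<^sup>T * - (1\<^sub>m n)) = A * 0\<^sub>m n n"
    using c X neg by (simp flip: add_assoc_mat_dim)
  moreover have "A * X + G + G * - (1\<^sub>m n) = A * X"
    using c X neg by (simp add: add_assoc_mat_dim)
  ultimately have "A * X + G + G' * - (1\<^sub>m n) = A' * 0\<^sub>m n n
      \<and> H * 0\<^sub>m n n + A\<^sup>T * (H * X + A\<^sup>T * - (1\<^sub>m n)) = H' * 0\<^sub>m n n + A'\<^sup>T * - (1\<^sub>m n)"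
    by (intro comp[of X "H * X + A\<^sup>T * - (1\<^sub>m n)"]) (use c X in auto)
  then have "A * X + G + - G' = 0\<^sub>m n n"
    using c' neg by simp
  then have "A * X + G = G'"
    using c c' X by (auto simp: mat_eq_iff)
  then show "G + A * N * G * A\<^sup>T = G'"
    using c X by (simp add: X_def simps)
qed

section \<open>The starting triple\<close>

text \<open>Here \<open>A\<close> stands for the shifted matrix. Multiplying \<open>K\<close> by the
  transposed inverse of \<open>A\<close> gives the identity plus a product through the small space,
  so the inverse of \<open>K\<close> is expressed by the small inverse \<open>P\<close>.\<close>

lemma gram_form_sda_start:
  fixes A B C :: "real mat" and c :: real
  assumes A: "A \<in> carrier_mat n n" and B: "B \<in> carrier_mat n m" and C: "C \<in> carrier_mat l n"
    and invA: "invertible_mat A" and K: "K = A\<^sup>T + C\<^sup>T * C * mat_inv A * (B * B\<^sup>T)"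
    and invK: "invertible_mat K"
  defines "Y \<equiv> B\<^sup>T * (mat_inv A)\<^sup>T * C\<^sup>T"
  shows "gram_form n m l c (1\<^sub>m n + c \<cdot>\<^sub>m mat_inv A) (mat_inv A * B) ((mat_inv A)\<^sup>T * C\<^sup>T) Y
    (mat_inv (1\<^sub>m m + Y * Y\<^sup>T)) (mat_inv (1\<^sub>m l + Y\<^sup>T * Y))
    (1\<^sub>m n + c \<cdot>\<^sub>m (mat_inv K)\<^sup>T) (c \<cdot>\<^sub>m (mat_inv A * (B * B\<^sup>T) * mat_inv K))
    (c \<cdot>\<^sub>m (mat_inv K * (C\<^sup>T * C) * mat_inv A))"
proof -
  define Ai where "Ai = mat_inv A"
  define Ki where "Ki = mat_inv K"
  define U where "U = Ai * B"
  define V where "V = Ai\<^sup>T * C\<^sup>T"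
  define P where "P = mat_inv (1\<^sub>m m + Y * Y\<^sup>T)"
  define Q where "Q = mat_inv (1\<^sub>m l + Y\<^sup>T * Y)"
  note Ai = mat_inv[OF A invA, folded Ai_def]
  have Kc: "K \<in> carrier_mat n n"
    using A B C Ai unfolding K by (auto simp: Ai_def)
  note Ki = mat_inv[OF Kc invK, folded Ki_def]
  have Y: "Y \<in> carrier_mat m l"
    using B C Ai by (auto simp: Y_def Ai_def)
  have Y_eq: "Y = B\<^sup>T * (Ai\<^sup>T * C\<^sup>T)"
    using B C Ai by (auto simp: Y_def Ai_def mat_dim_simps)
  note gram = mat_inv_gram[OF Y, folded P_def Q_def]
  note dims = carrier_matD[OF A] carrier_matD[OF B] carrier_matD[OF C] carrier_matD[OF Y]
    carrier_matD[OF Ai(1)] carrier_matD[OF Ki(1)] carrier_matD[OF gram(1)] carrier_matD[OF gram(5)]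
  note simps = dims mat_dim_simps add_mat_ac
  have AiA: "Ai\<^sup>T * A\<^sup>T = 1\<^sub>m n"
    using arg_cong[OF Ai(2), of transpose_mat] by (simp add: simps)
  have AiK: "Ai\<^sup>T * K = 1\<^sub>m n + V * Y\<^sup>T * B\<^sup>T"
    unfolding K Ai_def[symmetric] Y_eq V_def using AiA by (simp add: simps)
  \<comment> \<open>As \<open>B\<^sup>T * V = Y\<close>, one gets
    \<open>U\<^sup>T = (1 + Y * Y\<^sup>T) * (B\<^sup>T * Ki)\<close>, and \<open>P\<close> removes
    the factor.\<close>
  have BKi: "B\<^sup>T * Ki = P * U\<^sup>T"
  proof -
    have "U\<^sup>T = B\<^sup>T * (Ai\<^sup>T * K) * Ki"
      using Ki B Kc by (simp add: U_def simps)
    also have "\<dots> = B\<^sup>T * Ki + Y * Y\<^sup>T * B\<^sup>T * Ki"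
      unfolding AiK V_def Y_eq by (simp add: simps)
    finally have "P * U\<^sup>T = (P + P * Y * Y\<^sup>T) * (B\<^sup>T * Ki)"
      by (simp add: simps)
    then show ?thesis using gram by (simp add: dims)
  qed
  have Ki_eq: "Ki + V * Y\<^sup>T * P * U\<^sup>T = Ai\<^sup>T"
  proof -
    have "Ai\<^sup>T = (Ai\<^sup>T * K) * Ki"
      using Ki Kc by (simp add: simps)
    also have "\<dots> = Ki + V * Y\<^sup>T * (B\<^sup>T * Ki)"
      unfolding AiK V_def by (simp add: simps)
    also have "V * Y\<^sup>T * (B\<^sup>T * Ki) = V * Y\<^sup>T * P * U\<^sup>T"
      unfolding BKi V_def U_def by (simp add: simps)
    finally show ?thesis by simp
  qed
  \<comment> \<open>As \<open>U\<^sup>T * C\<^sup>T = Y\<close>, multiplying \<open>Ki_eq\<close> by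
    \<open>C\<^sup>T\<close> produces \<open>Y\<^sup>T * P * Y\<close>, the complement of
    \<open>Q\<close>.\<close>
  have KiC: "Ki * C\<^sup>T = V * Q"
  proof (rule add_right_imp_eq_mat[of _ "V * Y\<^sup>T * P * Y" _ n l])
    have "Ki * C\<^sup>T + V * Y\<^sup>T * P * Y = (Ki + V * Y\<^sup>T * P * U\<^sup>T) * C\<^sup>T"
      unfolding U_def V_def by (simp add: simps flip: Y_eq)
    also have "\<dots> = V * (Q + Y\<^sup>T * P * Y)"
      unfolding Ki_eq gram by (simp add: V_def dims)
    also have "\<dots> = V * Q + V * Y\<^sup>T * P * Y"
      unfolding V_def by (simp add: simps)
    finally show "Ki * C\<^sup>T + V * Y\<^sup>T * P * Y = V * Q + V * Y\<^sup>T * P * Y" .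
  qed (auto simp: dims V_def)
  have "gram_form n m l c (1\<^sub>m n + c \<cdot>\<^sub>m Ai) U V Y P Q
    (1\<^sub>m n + c \<cdot>\<^sub>m Ki\<^sup>T) (c \<cdot>\<^sub>m (Ai * (B * B\<^sup>T) * Ki)) (c \<cdot>\<^sub>m (Ki * (C\<^sup>T * C) * Ai))"
  proof
    have "Ki\<^sup>T + U * P * Y * V\<^sup>T = Ai"
      using arg_cong[OF Ki_eq, of transpose_mat] unfolding U_def V_def by (simp add: simps gram(4))
    then have "(1\<^sub>m n + c \<cdot>\<^sub>m Ki\<^sup>T) + c \<cdot>\<^sub>m (U * P * Y * V\<^sup>T) = 1\<^sub>m n + c \<cdot>\<^sub>m Ai"
      unfolding U_def V_def by (auto simp: simps simp flip: smult_add_mat_dim)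
    then show "1\<^sub>m n + c \<cdot>\<^sub>m Ki\<^sup>T = 1\<^sub>m n + c \<cdot>\<^sub>m Ai - c \<cdot>\<^sub>m (U * P * Y * V\<^sup>T)"
      by (subst minus_eq_iff_mat[of _ n n]) (auto simp: dims U_def V_def)
    have "Ai * (B * B\<^sup>T) * Ki = U * (B\<^sup>T * Ki)"
      unfolding U_def by (simp add: simps)
    then show "c \<cdot>\<^sub>m (Ai * (B * B\<^sup>T) * Ki) = c \<cdot>\<^sub>m (U * P * U\<^sup>T)"
      unfolding BKi unfolding U_def by (simp add: simps)
    have "Ki * (C\<^sup>T * C) * Ai = (Ki * C\<^sup>T) * V\<^sup>T"
      unfolding V_def by (simp add: simps)
    then show "c \<cdot>\<^sub>m (Ki * (C\<^sup>T * C) * Ai) = c \<cdot>\<^sub>m (V * Q * V\<^sup>T)"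
      unfolding KiC by simp
  qed (auto simp: dims U_def V_def P_def Q_def)
  then show ?thesis
    unfolding Ai_def Ki_def U_def V_def P_def Q_def .
qed

section \<open>Induction over the doubling steps\<close>

theorem theorem3p2:
  fixes n m l :: nat and \<gamma> :: real
    and A B C G H A\<gamma> K\<gamma> At :: "real mat"
    and Ak Gk Hk U V Uh Vh T Y :: "nat \<Rightarrow> real mat"
  assumes "0 < n" "0 < m" "0 < l" "m \<le> n" "l \<le> n"
    and "A \<in> carrier_mat n n" "B \<in> carrier_mat n m" "C \<in> carrier_mat l n"
    and "vec_space.rank n B = m" "vec_space.rank n C\<^sup>T = l"
    and "G = B * B\<^sup>T" "H = C\<^sup>T * C"
    and "0 < \<gamma>"
    and "A\<gamma> = A - \<gamma> \<cdot>\<^sub>m 1\<^sub>m n" "invertible_mat A\<gamma>"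
    and "K\<gamma> = A\<gamma>\<^sup>T + H * mat_inv A\<gamma> * G" "invertible_mat K\<gamma>"
    and "Ak 0 = 1\<^sub>m n + (2 * \<gamma>) \<cdot>\<^sub>m (mat_inv K\<gamma>)\<^sup>T"
    and "Gk 0 = (2 * \<gamma>) \<cdot>\<^sub>m (mat_inv A\<gamma> * G * mat_inv K\<gamma>)"
    and "Hk 0 = (2 * \<gamma>) \<cdot>\<^sub>m (mat_inv K\<gamma> * H * mat_inv A\<gamma>)"
    and "\<And>k. invertible_mat (1\<^sub>m n + Gk k * Hk k)"
    and "\<And>k. Ak (Suc k) = Ak k * mat_inv (1\<^sub>m n + Gk k * Hk k) * Ak k"
    and "\<And>k. Gk (Suc k) = Gk k + Ak k * mat_inv (1\<^sub>m n + Gk k * Hk k) * Gk k * (Ak k)\<^sup>T"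
    and "\<And>k. Hk (Suc k) = Hk k + (Ak k)\<^sup>T * Hk k * mat_inv (1\<^sub>m n + Gk k * Hk k) * Ak k"
    and "At = 1\<^sub>m n + (2 * \<gamma>) \<cdot>\<^sub>m mat_inv A\<gamma>"
    and "U 0 = mat_inv A\<gamma> * B" "\<And>j. U (Suc j) = At * U j"
    and "V 0 = (mat_inv A\<gamma>)\<^sup>T * C\<^sup>T" "\<And>j. V (Suc j) = At\<^sup>T * V j"
    and "\<And>k. Uh k = block_row n U (2 ^ k)"
    and "\<And>k. Vh k = block_row n V (2 ^ k)"
    and "\<And>k. T k = (Uh k)\<^sup>T * Vh k"
    and "Y 0 = B\<^sup>T * (mat_inv A\<gamma>)\<^sup>T * C\<^sup>T"
    and "\<And>k. Y (Suc k) =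
           four_block_mat (0\<^sub>m (2 ^ k * m) (2 ^ k * l)) (Y k)
                          (Y k)                       ((2 * \<gamma>) \<cdot>\<^sub>m T k)"
  shows "\<forall>k\<ge>1.
      Ak k = At ^\<^sub>m (2 ^ k)
        - (2 * \<gamma>) \<cdot>\<^sub>m (Uh k * mat_inv (1\<^sub>m (2 ^ k * m) + Y k * (Y k)\<^sup>T) * Y k * (Vh k)\<^sup>T)
    \<and> Gk k = (2 * \<gamma>) \<cdot>\<^sub>m (Uh k * mat_inv (1\<^sub>m (2 ^ k * m) + Y k * (Y k)\<^sup>T) * (Uh k)\<^sup>T)
    \<and> Hk k = (2 * \<gamma>) \<cdot>\<^sub>m (Vh k * mat_inv (1\<^sub>m (2 ^ k * l) + (Y k)\<^sup>T * Y k) * (Vh k)\<^sup>T)"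
proof -
  have B: "B \<in> carrier_mat n m" and C: "C \<in> carrier_mat l n"
    and G: "G = B * B\<^sup>T" and H: "H = C\<^sup>T * C" and A_def: "A\<gamma> = A - \<gamma> \<cdot>\<^sub>m 1\<^sub>m n" and invA: "invertible_mat A\<gamma>"
    and K: "K\<gamma> = A\<gamma>\<^sup>T + H * mat_inv A\<gamma> * G" and invK: "invertible_mat K\<gamma>"
    and init: "Ak 0 = 1\<^sub>m n + (2 * \<gamma>) \<cdot>\<^sub>m (mat_inv K\<gamma>)\<^sup>T"
      "Gk 0 = (2 * \<gamma>) \<cdot>\<^sub>m (mat_inv A\<gamma> * G * mat_inv K\<gamma>)"
      "Hk 0 = (2 * \<gamma>) \<cdot>\<^sub>m (mat_inv K\<gamma> * H * mat_inv A\<gamma>)"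
    and inv: "\<And>k. invertible_mat (1\<^sub>m n + Gk k * Hk k)"
    and step: "\<And>k. Ak (Suc k) = Ak k * mat_inv (1\<^sub>m n + Gk k * Hk k) * Ak k"
      "\<And>k. Gk (Suc k) = Gk k + Ak k * mat_inv (1\<^sub>m n + Gk k * Hk k) * Gk k * (Ak k)\<^sup>T"
      "\<And>k. Hk (Suc k) = Hk k + (Ak k)\<^sup>T * Hk k * mat_inv (1\<^sub>m n + Gk k * Hk k) * Ak k"
    and At: "At = 1\<^sub>m n + (2 * \<gamma>) \<cdot>\<^sub>m mat_inv A\<gamma>"
    and U0: "U 0 = mat_inv A\<gamma> * B" and US: "\<And>j. U (Suc j) = At * U j"
    and V0: "V 0 = (mat_inv A\<gamma>)\<^sup>T * C\<^sup>T" and VS: "\<And>j. V (Suc j) = At\<^sup>T * V j"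
    and Uh: "\<And>k. Uh k = block_row n U (2 ^ k)" and Vh: "\<And>k. Vh k = block_row n V (2 ^ k)"
    and T: "\<And>k. T k = (Uh k)\<^sup>T * Vh k" and Y0: "Y 0 = B\<^sup>T * (mat_inv A\<gamma>)\<^sup>T * C\<^sup>T"
    and YS: "\<And>k. Y (Suc k) = four_block_mat (0\<^sub>m (2 ^ k * m) (2 ^ k * l)) (Y k) (Y k) ((2 * \<gamma>) \<cdot>\<^sub>m T k)"
    by (fact assms)+
  have A: "A\<gamma> \<in> carrier_mat n n"
    using \<open>A \<in> carrier_mat n n\<close> by (auto simp: A_def)
  note Ai = mat_inv(1)[OF A invA]
  have At_carrier: "At \<in> carrier_mat n n" using Ai by (auto simp: At)
  have U: "U j \<in> carrier_mat n m" for j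
    by (induction j) (use At_carrier Ai B in \<open>auto simp: U0 US\<close>)
  have V: "V j \<in> carrier_mat n l" for j
    by (induction j) (use At_carrier Ai C in \<open>auto simp: V0 VS\<close>)
  define P where "P k = mat_inv (1\<^sub>m (2 ^ k * m) + Y k * (Y k)\<^sup>T)" for k
  define Q where "Q k = mat_inv (1\<^sub>m (2 ^ k * l) + (Y k)\<^sup>T * Y k)" for k
  \<comment> \<open>The induction starts at 0, where the block rows are the single blocks
    \<open>U 0\<close> and \<open>V 0\<close> and the power is \<open>At\<close>.\<close>
  have "gram_form n (2 ^ k * m) (2 ^ k * l) (2 * \<gamma>) (At ^\<^sub>m (2 ^ k)) (Uh k) (Vh k) (Y k) (P k) (Q k)
      (Ak k) (Gk k) (Hk k)" for k
  proof (induction k)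
    case 0
    have "block_row n M 1 = M 0" if "M 0 \<in> carrier_mat n r" for M :: "nat \<Rightarrow> real mat" and r
      using that mat_of_cols_cols[of "M 0"] by (simp add: block_row_def)
    from this[of U, OF U] this[of V, OF V] show ?case
      using gram_form_sda_start[OF A B C invA K[unfolded G H] invK, of "2 * \<gamma>"] At_carrier
      by (simp add: P_def Q_def Uh Vh U0 V0 Y0 init At G H)
  next
    case (Suc k)
    interpret old: gram_form n "2 ^ k * m" "2 ^ k * l" "2 * \<gamma>" "At ^\<^sub>m (2 ^ k)" "Uh k" "Vh k" "Y k"
      "P k" "Q k" "Ak k" "Gk k" "Hk k" by (rule Suc)
    let ?F = "At ^\<^sub>m (2 ^ k)"
    \<comment> \<open>The closed forms are named first: \<open>?A\<close>, \<open>?G\<close>,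
      \<open>?H\<close> satisfy the invariant by definition, and \<open>sda_step\<close> then
      identifies them with the next iterates.\<close>
    let ?A = "At ^\<^sub>m (2 ^ Suc k) - (2 * \<gamma>) \<cdot>\<^sub>m (Uh (Suc k) * P (Suc k) * Y (Suc k) * (Vh (Suc k))\<^sup>T)"
    let ?G = "(2 * \<gamma>) \<cdot>\<^sub>m (Uh (Suc k) * P (Suc k) * (Uh (Suc k))\<^sup>T)"
    let ?H = "(2 * \<gamma>) \<cdot>\<^sub>m (Vh (Suc k) * Q (Suc k) * (Vh (Suc k))\<^sup>T)"
    have F: "At ^\<^sub>m (2 ^ Suc k) = ?F * ?F"
      by (simp add: mult_2 power_mat_add[OF At_carrier])
    have UhS: "Uh (Suc k) = hstack (Uh k) (?F * Uh k)"
      unfolding Uh by (rule block_row_doubling[where p = m, OF At_carrier]) (rule U US)+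
    have VhS: "Vh (Suc k) = hstack (Vh k) (?F\<^sup>T * Vh k)"
      unfolding Vh transpose_power_mat[OF At_carrier]
      by (rule block_row_doubling[where p = l]) (use At_carrier V VS in auto)
    \<comment> \<open>\<open>sda_step\<close> expects the doubled sizes as sums.\<close>
    have dim: "2 ^ Suc k * r = 2 ^ k * r + 2 ^ k * r" for r :: nat
      by simp
    have new: "gram_form n (2 ^ Suc k * m) (2 ^ Suc k * l) (2 * \<gamma>) (At ^\<^sub>m (2 ^ Suc k)) (Uh (Suc k)) (Vh (Suc k))
        (Y (Suc k)) (P (Suc k)) (Q (Suc k)) ?A ?G ?H"
    proof
      show "At ^\<^sub>m (2 ^ Suc k) \<in> carrier_mat n n"
        using At_carrier by (rule pow_carrier_mat)
      show "Uh (Suc k) \<in> carrier_mat n (2 ^ Suc k * m)" "Vh (Suc k) \<in> carrier_mat n (2 ^ Suc k * l)"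
        unfolding Uh Vh by (rule block_row_carrier, rule U V)+
      show "Y (Suc k) \<in> carrier_mat (2 ^ Suc k * m) (2 ^ Suc k * l)"
        unfolding YS T dim using old.Y old.U old.V by (intro four_block_carrier_mat) auto
    qed (simp_all only: P_def Q_def)
    have "Ak (Suc k) = ?A" "Gk (Suc k) = ?G" "Hk (Suc k) = ?H"
      unfolding step using sda_step[OF Suc new[unfolded dim F UhS VhS YS T] inv]
      unfolding F UhS VhS YS T by auto
    with new show ?case by simp
  qed
  then show ?thesis
    unfolding gram_form_def P_def Q_def by blast
qed

end
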